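(* Let $G$ be a finitely generated group, and let $\pi_1$ and $\pi_2$ be representations of $G$ on separable Hilbert spaces $\mathcal{H}_1$ and $\mathcal{H}_2$, each of which is either real (in which case the representation is orthogonal) or complex (in which case the representation is unitary). Suppose that $\pi_1$ and $\pi_2$ are additive conjugates. Then $\pi_1$ has almost invariant vectors if and only if $\pi_2$ has almost invariant vectors.
   Context: Two representations $\pi$ on $\mathcal{H}$ and $\pi'$ on $\mathcal{H}'$ of $G$ are additive conjugates if there exists a bijection $\xi \colon \mathcal{H} \to \mathcal{H}'$, not necessarily continuous, such that for all $v,w \in \mathcal{H}$ and $g \in G$, $\xi(v+w) = \xi(v)+\xi(w)$ and $\xi(\pi_g v) = \pi'_g \xi(v)$. A representation $\pi$ on $\mathcal{H}$ has almost invariant vectors if there exists a sequence of unit vectors $(u_n)_n$ in $\mathcal{H}$ such that $\lim_n \Vert \pi_g u_n - u_n\Vert = 0$ for each $g \in G$. *)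

theory Defs
  imports "HOL-Analysis.Analysis" "HOL-Algebra.Generated_Groups" "HOL-Algebra.Group_Action"
begin

definition finitely_generated :: "('g, 'm) monoid_scheme \<Rightarrow> bool" where
  "finitely_generated G \<longleftrightarrow> (\<exists>S. finite S \<and> S \<subseteq> carrier G \<and> generate G S = carrier G)"

text \<open>
  Real Hilbert spaces are types of class \<open>{real_inner, complete_space}\<close>. A complex Hilbert
  space is such a type, which supplies the norm, the topology and completeness, together with a
  complex scalar multiplication extending the real one and a complex inner product whose real part
  is the real one. In particular \<open>cinner x x = (norm x)\<^sup>2\<close>, so both inner products induce the
  same norm. The complex inner product is linear in its first argument.
\<close>

locale complex_inner_structure = vector_space scaleC
  for scaleC :: "complex \<Rightarrow> 'a :: real_inner \<Rightarrow> 'a" +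
  fixes cinner :: "'a \<Rightarrow> 'a \<Rightarrow> complex"
  assumes scaleC_of_real: "scaleC (of_real r) x = r *\<^sub>R x"
    and cinner_commute: "cinner y x = cnj (cinner x y)"
    and cinner_add_left: "cinner (x + y) z = cinner x z + cinner y z"
    and cinner_scaleC_left: "cinner (scaleC c x) y = c * cinner x y"
    and Re_cinner: "Re (cinner x y) = inner x y"
begin

lemma cinner_self: "cinner x x = of_real ((norm x)\<^sup>2)"
  using cinner_commute[of x x] Re_cinner[of x x]
  by (simp add: complex_eq_iff power2_norm_eq_inner)

end

lemma complex_inner_structure_complex:
  "complex_inner_structure (*) (\<lambda>x y :: complex. x * cnj y)"
  by unfold_locales (auto simp: algebra_simps scaleR_conv_of_real inner_complex_def)

text \<open>
  \<open>group_action G UNIV \<pi>\<close> says that \<open>\<pi>\<close> is a homomorphism from \<open>G\<close> to the group of all bijections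
  of the type, so the operators \<open>\<pi> g\<close> below are surjective as well as inner product preserving.
  No continuity in \<open>g\<close> is required: \<open>G\<close> carries no topology.
\<close>

definition orthogonal_representation ::
  "('g, 'm) monoid_scheme \<Rightarrow> ('g \<Rightarrow> 'a :: {real_inner, complete_space} \<Rightarrow> 'a) \<Rightarrow> bool" where
  "orthogonal_representation G \<pi> \<longleftrightarrow>
     group_action G UNIV \<pi> \<and> (\<forall>g\<in>carrier G. orthogonal_transformation (\<pi> g))"

definition unitary_representation ::
  "('g, 'm) monoid_scheme \<Rightarrow> (complex \<Rightarrow> 'a \<Rightarrow> 'a) \<Rightarrow> ('a \<Rightarrow> 'a \<Rightarrow> complex) \<Rightarrow>
     ('g \<Rightarrow> 'a :: {real_inner, complete_space} \<Rightarrow> 'a) \<Rightarrow> bool" where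
  "unitary_representation G scaleC cinner \<pi> \<longleftrightarrow>
     complex_inner_structure scaleC cinner \<and>
     group_action G UNIV \<pi> \<and>
     (\<forall>g\<in>carrier G. Vector_Spaces.linear scaleC scaleC (\<pi> g) \<and>
        (\<forall>v w. cinner (\<pi> g v) (\<pi> g w) = cinner v w))"

definition additive_conjugates ::
  "('g, 'm) monoid_scheme \<Rightarrow> ('g \<Rightarrow> 'a :: ab_group_add \<Rightarrow> 'a) \<Rightarrow>
     ('g \<Rightarrow> 'b :: ab_group_add \<Rightarrow> 'b) \<Rightarrow> bool" where
  "additive_conjugates G \<pi> \<pi>' \<longleftrightarrow>
     (\<exists>\<xi> :: 'a \<Rightarrow> 'b. bij \<xi> \<and> (\<forall>v w. \<xi> (v + w) = \<xi> v + \<xi> w) \<and>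
        (\<forall>g\<in>carrier G. \<forall>v. \<xi> (\<pi> g v) = \<pi>' g (\<xi> v)))"

definition almost_invariant_vectors ::
  "('g, 'm) monoid_scheme \<Rightarrow> ('g \<Rightarrow> 'a :: real_normed_vector \<Rightarrow> 'a) \<Rightarrow> bool" where
  "almost_invariant_vectors G \<pi> \<longleftrightarrow>
     (\<exists>u :: nat \<Rightarrow> 'a. (\<forall>n. norm (u n) = 1) \<and>
        (\<forall>g\<in>carrier G. (\<lambda>n. norm (\<pi> g (u n) - u n)) \<longlonglongrightarrow> 0))"

end

theory Submission
  imports Defs
begin

text \<open>
  Let \<open>S\<close> be a finite generating set. The representation has almost invariant vectors iff the
  positive operator \<open>\<Delta> = (\<Sum>s\<in>S. 2 - \<pi> s - \<pi> (inv s))\<close> is not bounded below, since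
  \<open>\<Delta> v \<bullet> v = (\<Sum>s\<in>S. (norm (\<pi> s v - v))\<^sup>2)\<close>. A bounded positive operator is bounded below iff
  it is bijective, and bijectivity of \<open>\<Delta>\<close> is visible to additive conjugation, because \<open>\<Delta>\<close> is an
  integral combination of the operators \<open>\<pi> g\<close>.
\<close>

section \<open>Coercive and symmetric operators on a real Hilbert space\<close>

text \<open>The Lax-Milgram argument: coercivity leaves only 0 in the kernel, and
  \<open>A x = y\<close> is solved by Banach's fixed point theorem for the map
  \<open>x - t *\<^sub>R (A x - y)\<close> with a small step \<open>t\<close>.\<close>

lemma bij_coercive:
  fixes A :: "'a :: {real_inner, complete_space} \<Rightarrow> 'a"
  assumes "bounded_linear A" and "c > 0" and coercive: "\<And>v. c * (norm v)\<^sup>2 \<le> A v \<bullet> v"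
  shows "bij A"
proof (rule bijI)
  interpret A: bounded_linear A by fact
  have "v = 0" if "A v = 0" for v
    using coercive[of v] that \<open>c > 0\<close> by (simp add: mult_le_0_iff)
  then show "inj A"
    using A.linear_axioms linear_injective_0 by blast
  show "surj A"
  proof (unfold surj_def, rule allI)
    fix y
    obtain M where M: "M > 0" "\<And>v. norm (A v) \<le> norm v * M"
      using A.pos_bounded by blast
    \<comment> \<open>With \<open>K > c\<close>, the product \<open>t * c = (c / K)\<^sup>2\<close>
      below stays under 1, so \<open>q\<close> is the root of a positive number.\<close>
    define K where "K = M + c"
    have K: "K > c" "K > 0" "norm (A v) \<le> norm v * K" for v
      using M(1) M(2)[of v] \<open>c > 0\<close> by (simp_all add: K_def distrib_left add_increasing2)
    \<comment> \<open>This step minimises \<open>1 - 2 * t * c + t\<^sup>2 * K\<^sup>2\<close>, the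
      estimate for the squared contraction factor; the minimum is \<open>1 - t * c\<close>.\<close>
    define t where "t = c / K\<^sup>2"
    define q where "q = sqrt (1 - t * c)"
    have "t > 0" using \<open>c > 0\<close> K by (simp add: t_def)
    have tc: "t * c \<le> 1" "t * c > 0"
      using \<open>c > 0\<close> K by (auto simp: t_def divide_simps power2_eq_square mult_mono)
    have tK: "t\<^sup>2 * K\<^sup>2 = t * c"
      using K(2) by (simp add: t_def power2_eq_square)
    have contract: "norm (v - t *\<^sub>R A v) \<le> q * norm v" for v
    proof -
      have "(norm (v - t *\<^sub>R A v))\<^sup>2 = (norm v)\<^sup>2 - 2 * t * (A v \<bullet> v) + t\<^sup>2 * (norm (A v))\<^sup>2"
        unfolding power2_norm_eq_inner
        by (simp add: algebra_simps inner_commute power2_eq_square)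
      also have "\<dots> \<le> (norm v)\<^sup>2 - 2 * t * (c * (norm v)\<^sup>2) + t\<^sup>2 * (norm v * K)\<^sup>2"
        using \<open>t > 0\<close> coercive[of v] K(3)[of v]
        by (intro add_mono diff_mono mult_left_mono power_mono) auto
      also have "t\<^sup>2 * (norm v * K)\<^sup>2 = t * c * (norm v)\<^sup>2"
        by (simp add: power_mult_distrib tK[symmetric])
      also have "(norm v)\<^sup>2 - 2 * t * (c * (norm v)\<^sup>2) + t * c * (norm v)\<^sup>2 = (q * norm v)\<^sup>2"
        using tc by (simp add: q_def power_mult_distrib algebra_simps)
      finally show ?thesis
        by (rule power2_le_imp_le) (use tc in \<open>simp add: q_def\<close>)
    qed
    have "\<exists>!x. x - t *\<^sub>R (A x - y) = x"
    proof (rule banach_fix_type)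
      show "0 \<le> q" "q < 1"
        using tc by (auto simp: q_def)
      show "\<forall>v w. dist (v - t *\<^sub>R (A v - y)) (w - t *\<^sub>R (A w - y)) \<le> q * dist v w"
      proof (intro allI)
        fix v w
        show "dist (v - t *\<^sub>R (A v - y)) (w - t *\<^sub>R (A w - y)) \<le> q * dist v w"
          using contract[of "v - w"] by (simp add: dist_norm A.diff algebra_simps)
      qed
    qed
    then show "\<exists>x. y = A x"
      using \<open>t > 0\<close> by auto
  qed
qed

text \<open>
  The inverse \<open>T\<close> of a bijective symmetric operator is symmetric, so its sublevel sets
  \<open>{y. norm (T y) \<le> n}\<close> are closed, and Baire's theorem gives one of them interior.
\<close>

lemma bounded_below_bij_symmetric:
  fixes A :: "'a :: {real_inner, complete_space} \<Rightarrow> 'a"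
  assumes "linear A" and sym: "\<And>v w. A v \<bullet> w = v \<bullet> A w" and "bij A"
  obtains c where "c > 0" and "\<And>v. c * norm v \<le> norm (A v)"
proof -
  interpret A: linear A by fact
  define T where "T = inv_into UNIV A"
  have AT: "A (T y) = y" and TA: "T (A y) = y" for y
    using \<open>bij A\<close> by (simp_all add: T_def bij_is_surj surj_f_inv_f bij_is_inj)
  have symT: "T v \<bullet> w = v \<bullet> T w" for v w
    using sym[of "T v" "T w"] by (simp add: AT)
  have T_diff: "T (v - w) = T v - T w" for v w
    by (metis A.diff AT TA)
  have T_scale: "T (r *\<^sub>R v) = r *\<^sub>R T v" for r v
    by (metis A.scaleR AT TA)
  define C where "C n = {y. norm (T y) \<le> real n}" for n
  \<comment> \<open>Continuity of \<open>T\<close> is not yet known. Symmetry turns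
    \<open>norm (T y)\<close> into the supremum of \<open>y \<bullet> T x\<close> over the unit
    ball, and each of these functionals is continuous in \<open>y\<close>.\<close>
  have C_eq: "C n = (\<Inter>x\<in>cball 0 1. {y. y \<bullet> T x \<le> real n})" for n
  proof (intro equalityI subsetI)
    fix y assume y: "y \<in> C n"
    have "y \<bullet> T x \<le> real n" if "norm x \<le> 1" for x
    proof -
      have "y \<bullet> T x \<le> norm (T y) * norm x"
        using norm_cauchy_schwarz[of "T y" x] by (simp add: symT)
      also have "\<dots> \<le> norm (T y)"
        using that by (simp add: mult_left_le)
      finally show ?thesis using y by (simp add: C_def)
    qed
    then show "y \<in> (\<Inter>x\<in>cball 0 1. {y. y \<bullet> T x \<le> real n})" by simp
  next
    fix y assume y: "y \<in> (\<Inter>x\<in>cball 0 1. {y. y \<bullet> T x \<le> real n})"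
    \<comment> \<open>\<open>sgn (T y)\<close> attains the supremum. It is 0 when
      \<open>T y = 0\<close>, hence the ball and not the sphere.\<close>
    have "norm (sgn (T y)) \<le> 1" by (simp add: norm_sgn)
    then have "y \<bullet> T (sgn (T y)) \<le> real n" using y by simp
    moreover have "y \<bullet> T (sgn (T y)) = norm (T y)"
      by (cases "T y = 0") (simp_all add: symT[symmetric] sgn_div_norm dot_square_norm power2_eq_square)
    ultimately show "y \<in> C n" by (simp add: C_def)
  qed
  have closed_C: "closed (C n)" for n
    unfolding C_eq by (intro closed_INT ballI closed_Collect_le continuous_intros)
  have "\<exists>n. interior (C n) \<noteq> {}"
  proof (rule ccontr)
    assume "\<not> ?thesis"
    then have "euclidean interior_of \<Union>(range C) = {}"
      using closed_C completely_metrizable_space_euclidean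
      by (intro Baire_category_alt) auto
    moreover have "\<Union>(range C) = UNIV"
      using real_arch_simple by (fastforce simp: C_def)
    ultimately show False by simp
  qed
  then obtain n y r where "r > 0" and ball: "ball y r \<subseteq> C n"
    by (meson equals0I mem_interior)
  \<comment> \<open>Such a \<open>z\<close> is the difference of \<open>y + z\<close> and
    \<open>y\<close>, both in the ball, so the bound moves from \<open>y\<close> to 0 at the cost of
    a factor 2.\<close>
  have bound: "norm (T z) \<le> 2 * real n" if "norm z < r" for z
  proof -
    have "y + z \<in> C n" "y \<in> C n"
      using ball that \<open>r > 0\<close> by (auto simp: dist_norm subset_iff)
    then show ?thesis
      using T_diff[of "y + z" y] norm_triangle_ineq4[of "T (y + z)" "T y"] by (simp add: C_def)
  qed
  \<comment> \<open>Rescaling \<open>A v\<close> to norm \<open>r / 2\<close> yields the factor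
    \<open>4 * real n\<close>; the summand 1 keeps the later divisor positive when
    \<open>n = 0\<close>.\<close>
  have "r * norm v \<le> (4 * real n + 1) * norm (A v)" for v
  proof (cases "v = 0")
    case False
    then have "A v \<noteq> 0"
      by (metis A.zero TA)
    define z where "z = (r / (2 * norm (A v))) *\<^sub>R A v"
    have "norm z < r"
      using \<open>A v \<noteq> 0\<close> \<open>r > 0\<close> by (simp add: z_def)
    moreover have "T z = (r / (2 * norm (A v))) *\<^sub>R v"
      by (simp add: z_def T_scale TA)
    ultimately have "(r / (2 * norm (A v))) * norm v \<le> 2 * real n"
      using bound[of z] \<open>r > 0\<close> by simp
    then have "r * norm v \<le> 4 * real n * norm (A v)"
      using \<open>A v \<noteq> 0\<close> by (simp add: field_simps)
    then show ?thesis
      by (simp add: algebra_simps add_increasing)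
  qed simp
  then have "r / (4 * real n + 1) * norm v \<le> norm (A v)" for v
    by (simp add: field_simps)
  then show ?thesis
    using that[of "r / (4 * real n + 1)"] \<open>r > 0\<close> by (simp add: add_nonneg_pos)
qed

section \<open>Orthogonal representations and the Laplacian of a generating set\<close>

text \<open>Forgetting the complex structure keeps the norm, so real, complex and mixed pairs all
  reduce to the orthogonal case.\<close>

lemma unitary_imp_orthogonal_representation:
  assumes "unitary_representation G scaleC cinner \<pi>"
  shows "orthogonal_representation G \<pi>"
  unfolding orthogonal_representation_def
proof (intro conjI ballI)
  interpret complex_inner_structure scaleC cinner
    using assms by (simp add: unitary_representation_def)
  show "group_action G UNIV \<pi>"
    using assms by (simp add: unitary_representation_def)
  fix g assume "g \<in> carrier G"
  then have lin: "Vector_Spaces.linear scaleC scaleC (\<pi> g)"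
    and cinner: "\<And>v w. cinner (\<pi> g v) (\<pi> g w) = cinner v w"
    using assms by (auto simp: unitary_representation_def)
  interpret L: Vector_Spaces.linear scaleC scaleC "\<pi> g" by fact
  have "linear (\<pi> g)"
    by (rule linearI) (simp_all add: L.add L.scale flip: scaleC_of_real)
  then show "orthogonal_transformation (\<pi> g)"
    by (simp add: orthogonal_transformation_def cinner flip: Re_cinner)
qed

text \<open>Only sums and differences occur, with no scalar 2, so the operator makes sense on any
  abelian group and additive maps can transport it.\<close>

definition laplacian ::
  "('g, 'm) monoid_scheme \<Rightarrow> 'g set \<Rightarrow> ('g \<Rightarrow> 'a :: ab_group_add \<Rightarrow> 'a) \<Rightarrow> 'a \<Rightarrow> 'a" where
  "laplacian G S \<pi> v = (\<Sum>s\<in>S. (v - \<pi> s v) + (v - \<pi> (inv\<^bsub>G\<^esub> s) v))"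

text \<open>The conjugating bijection preserves finite sums and differences, hence intertwines the
  two Laplacians.\<close>

lemma bij_laplacian_conjugate:
  fixes \<pi> :: "'g \<Rightarrow> 'a :: ab_group_add \<Rightarrow> 'a" and \<pi>' :: "'g \<Rightarrow> 'b :: ab_group_add \<Rightarrow> 'b"
  assumes "group G" and "S \<subseteq> carrier G" and "additive_conjugates G \<pi> \<pi>'"
  shows "bij (laplacian G S \<pi>) \<longleftrightarrow> bij (laplacian G S \<pi>')"
proof -
  obtain \<xi> :: "'a \<Rightarrow> 'b" where \<xi>: "bij \<xi>" "\<And>v w. \<xi> (v + w) = \<xi> v + \<xi> w"
    "\<And>g v. g \<in> carrier G \<Longrightarrow> \<xi> (\<pi> g v) = \<pi>' g (\<xi> v)"
    using assms(3) by (auto simp: additive_conjugates_def)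
  interpret \<xi>: Modules.additive \<xi>
    by unfold_locales (rule \<xi>(2))
  have inv: "inv\<^bsub>G\<^esub> s \<in> carrier G" "s \<in> carrier G" if "s \<in> S" for s
    using assms(1,2) that by auto
  have "\<xi> \<circ> laplacian G S \<pi> = laplacian G S \<pi>' \<circ> \<xi>"
    by (auto simp: laplacian_def fun_eq_iff \<xi>.sum \<xi>.add \<xi>.diff \<xi>(3) inv intro!: sum.cong)
  then show ?thesis
    using bij_betw_comp_iff[OF \<xi>(1), of "laplacian G S \<pi>'" UNIV]
      bij_betw_comp_iff2[OF \<xi>(1), of "laplacian G S \<pi>" UNIV] by simp
qed

text \<open>A bijective Laplacian is bounded below, which almost invariant unit vectors contradict.
  If it is not bijective, every coercivity bound fails somewhere, and normalising vectors where it
  fails gives almost invariant ones.\<close>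

lemma almost_invariant_vectors_iff_not_bij_laplacian:
  fixes \<pi> :: "'g \<Rightarrow> 'a :: {real_inner, complete_space} \<Rightarrow> 'a"
  assumes "group G" and "finite S" and S: "S \<subseteq> carrier G" and gen: "generate G S = carrier G"
    and rep: "orthogonal_representation G \<pi>"
  shows "almost_invariant_vectors G \<pi> \<longleftrightarrow> \<not> bij (laplacian G S \<pi>)"
proof -
  interpret group G by fact
  interpret group_action G UNIV \<pi>
    using rep by (simp add: orthogonal_representation_def)
  have orth: "orthogonal_transformation (\<pi> g)" if "g \<in> carrier G" for g
    using rep that by (simp add: orthogonal_representation_def)
  have bl: "bounded_linear (\<pi> g)" if "g \<in> carrier G" for g
  proof -
    have "linear (\<pi> g)" and "\<And>v. norm (\<pi> g v) = norm v"
      using orth[OF that] by (auto intro: orthogonal_transformation_linear orthogonal_transformation_norm)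
    then show ?thesis
      by (auto simp: bounded_linear_def bounded_linear_axioms_def intro: exI[of _ 1])
  qed
  have inner_\<pi>: "\<pi> g v \<bullet> \<pi> g w = v \<bullet> w" and norm_\<pi>: "norm (\<pi> g v) = norm v"
    and diff_\<pi>: "\<pi> g (v - w) = \<pi> g v - \<pi> g w" if "g \<in> carrier G" for g v w
    using orth[OF that] bl[OF that]
    by (auto simp: orthogonal_transformation_def norm_eq_sqrt_inner linear_simps)
  have one: "\<pi> \<one>\<^bsub>G\<^esub> v = v" for v
    by (simp flip: id_eq_one)
  have inv_r: "\<pi> g (\<pi> (inv\<^bsub>G\<^esub> g) v) = v" if "g \<in> carrier G" for g v
    using that by (simp add: one flip: composition_rule)
  have inv_inner: "\<pi> (inv\<^bsub>G\<^esub> g) v \<bullet> w = v \<bullet> \<pi> g w" if "g \<in> carrier G" for g v w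
    using inner_\<pi>[OF that, of "\<pi> (inv\<^bsub>G\<^esub> g) v" w] by (simp add: inv_r that)
  \<comment> \<open>The isometry \<open>\<pi> g\<close> sends \<open>\<pi> (inv g) v - v\<close> to
    \<open>v - \<pi> g v\<close>.\<close>
  have norm_inv: "norm (\<pi> (inv\<^bsub>G\<^esub> g) v - v) = norm (\<pi> g v - v)" if "g \<in> carrier G" for g v
    using norm_\<pi>[OF that, of "\<pi> (inv\<^bsub>G\<^esub> g) v - v"]
    by (simp add: diff_\<pi> inv_r that norm_minus_commute)
  have inS: "s \<in> carrier G" "inv\<^bsub>G\<^esub> s \<in> carrier G" if "s \<in> S" for s
    using S that by auto
  let ?\<Delta> = "laplacian G S \<pi>"
  have bl_\<Delta>: "bounded_linear ?\<Delta>"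
    unfolding laplacian_def
    by (intro bounded_linear_sum bounded_linear_add bounded_linear_sub bounded_linear_ident bl inS)
  have sym_\<Delta>: "?\<Delta> v \<bullet> w = v \<bullet> ?\<Delta> w" for v w
    unfolding laplacian_def inner_sum_left inner_sum_right
  proof (intro sum.cong refl)
    fix s assume "s \<in> S"
    then show "(v - \<pi> s v + (v - \<pi> (inv\<^bsub>G\<^esub> s) v)) \<bullet> w = v \<bullet> (w - \<pi> s w + (w - \<pi> (inv\<^bsub>G\<^esub> s) w))"
      using inv_inner[of s v w] inv_inner[of s w v] inS
      by (simp add: inner_add_left inner_add_right inner_diff_left inner_diff_right inner_commute)
  qed
  have inner_\<Delta>: "?\<Delta> v \<bullet> v = (\<Sum>s\<in>S. (norm (\<pi> s v - v))\<^sup>2)" for v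
    unfolding laplacian_def inner_sum_left
  proof (intro sum.cong refl)
    fix s assume "s \<in> S"
    then show "(v - \<pi> s v + (v - \<pi> (inv\<^bsub>G\<^esub> s) v)) \<bullet> v = (norm (\<pi> s v - v))\<^sup>2"
      using inv_inner[of s v v] inS unfolding power2_norm_eq_inner
      by (simp add: inner_add_left inner_add_right inner_diff_left inner_diff_right inner_\<pi> inner_commute)
  qed
  have norm_\<Delta>: "norm (?\<Delta> v) \<le> (\<Sum>s\<in>S. 2 * norm (\<pi> s v - v))" for v
    unfolding laplacian_def
  proof (rule sum_norm_le)
    fix s assume "s \<in> S"
    then show "norm (v - \<pi> s v + (v - \<pi> (inv\<^bsub>G\<^esub> s) v)) \<le> 2 * norm (\<pi> s v - v)"
      using norm_triangle_ineq[of "v - \<pi> s v" "v - \<pi> (inv\<^bsub>G\<^esub> s) v"] norm_inv[of s v] inS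
      by (simp add: norm_minus_commute)
  qed
  show ?thesis
  proof
    assume "almost_invariant_vectors G \<pi>"
    then obtain u where u: "\<And>n. norm (u n) = 1"
      and lim: "\<And>g. g \<in> carrier G \<Longrightarrow> (\<lambda>n. norm (\<pi> g (u n) - u n)) \<longlonglongrightarrow> 0"
      by (auto simp: almost_invariant_vectors_def)
    show "\<not> bij ?\<Delta>"
    proof
      assume "bij ?\<Delta>"
      then obtain c where c: "c > 0" "\<And>v. c * norm v \<le> norm (?\<Delta> v)"
        using bounded_below_bij_symmetric[of ?\<Delta>] bl_\<Delta> sym_\<Delta> bounded_linear.linear by metis
      have "(\<lambda>n. \<Sum>s\<in>S. 2 * norm (\<pi> s (u n) - u n)) \<longlonglongrightarrow> (\<Sum>s\<in>S. 2 * 0)"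
        by (intro tendsto_intros lim inS)
      moreover have "c \<le> (\<Sum>s\<in>S. 2 * norm (\<pi> s (u n) - u n))" for n
        using c(2)[of "u n"] norm_\<Delta>[of "u n"] u by simp
      ultimately have "c \<le> 0"
        by (intro LIMSEQ_le_const) auto
      then show False using c by simp
    qed
  next
    assume "\<not> bij ?\<Delta>"
    \<comment> \<open>Contrapositive of \<open>bij_coercive\<close> with the constants
      \<open>1 / (n + 1)\<close>, which tend to 0.\<close>
    then have "\<exists>v. ?\<Delta> v \<bullet> v < inverse (real (Suc n)) * (norm v)\<^sup>2" for n
      using bij_coercive[OF bl_\<Delta>, of "inverse (real (Suc n))"] by (force simp: not_le)
    then obtain v where v: "\<And>n. ?\<Delta> (v n) \<bullet> v n < inverse (real (Suc n)) * (norm (v n))\<^sup>2"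
      by metis
    have v0: "v n \<noteq> 0" for n
      using v[of n] by auto
    define u where "u n = sgn (v n)" for n
    have u: "norm (u n) = 1" for n
      using v0 by (simp add: u_def norm_sgn)
    have \<Delta>u: "?\<Delta> (u n) \<bullet> u n \<le> inverse (real (Suc n))" for n
    proof -
      have "?\<Delta> (u n) \<bullet> u n = ?\<Delta> (v n) \<bullet> v n / (norm (v n))\<^sup>2"
        by (simp add: u_def sgn_div_norm linear_simps(5)[OF bl_\<Delta>] power2_eq_square field_simps)
      also have "\<dots> \<le> inverse (real (Suc n))"
        using v[of n] v0[of n] by (simp add: divide_le_eq)
      finally show ?thesis .
    qed
    have lim_S: "(\<lambda>n. norm (\<pi> s (u n) - u n)) \<longlonglongrightarrow> 0" if "s \<in> S" for s
    proof -
      \<comment> \<open>One term of the nonnegative sum \<open>inner_\<Delta>\<close> is at most the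
        whole sum.\<close>
      have "(norm (\<pi> s (u n) - u n))\<^sup>2 \<le> inverse (real (Suc n))" for n
        using \<Delta>u[of n] member_le_sum[OF that, of "\<lambda>s. (norm (\<pi> s (u n) - u n))\<^sup>2"] \<open>finite S\<close>
        by (simp add: inner_\<Delta>)
      then have "(\<lambda>n. (norm (\<pi> s (u n) - u n))\<^sup>2) \<longlonglongrightarrow> 0"
        by (intro tendsto_sandwich[OF _ _ tendsto_const LIMSEQ_inverse_real_of_nat]) auto
      then show ?thesis
        by simp
    qed
    have "(\<lambda>n. norm (\<pi> g (u n) - u n)) \<longlonglongrightarrow> 0" if "g \<in> generate G S" for g
      using that
    proof induction
      case one
      show ?case by (simp add: \<open>\<And>v. \<pi> \<one>\<^bsub>G\<^esub> v = v\<close>)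
    next
      case (incl s)
      then show ?case by (rule lim_S)
    next
      case (inv s)
      then show ?case using lim_S inS by (simp add: norm_inv)
    next
      case (eng g h)
      then have gh: "g \<in> carrier G" "h \<in> carrier G" by (simp_all add: gen)
      \<comment> \<open>Splits the displacement as
        \<open>\<pi> g (\<pi> h w - w) + (\<pi> g w - w)\<close>, where \<open>\<pi> g\<close> is an
        isometry.\<close>
      have "norm (\<pi> (g \<otimes>\<^bsub>G\<^esub> h) w - w) \<le> norm (\<pi> h w - w) + norm (\<pi> g w - w)" for w
        using norm_triangle_ineq[of "\<pi> g (\<pi> h w - w)" "\<pi> g w - w"] gh
        by (simp add: composition_rule norm_\<pi>) (simp add: diff_\<pi>)
      then show ?case
        by (intro tendsto_sandwich[OF _ _ tendsto_const tendsto_add_zero[OF eng.IH(2,1)]]) auto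
    qed
    then show "almost_invariant_vectors G \<pi>"
      using u by (auto simp: almost_invariant_vectors_def gen)
  qed
qed

theorem corollary2:
  fixes G :: "('g, 'm) monoid_scheme"
    and \<pi>1 :: "'g \<Rightarrow> 'a :: {real_inner, complete_space} \<Rightarrow> 'a"
    and \<pi>2 :: "'g \<Rightarrow> 'b :: {real_inner, complete_space} \<Rightarrow> 'b"
  assumes "group G" and "finitely_generated G"
    and "separable_space (euclidean :: 'a topology)"
    and "separable_space (euclidean :: 'b topology)"
    and "orthogonal_representation G \<pi>1 \<or>
         (\<exists>scaleC cinner. unitary_representation G scaleC cinner \<pi>1)"
    and "orthogonal_representation G \<pi>2 \<or>
         (\<exists>scaleC cinner. unitary_representation G scaleC cinner \<pi>2)"
    and "additive_conjugates G \<pi>1 \<pi>2"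
  shows "almost_invariant_vectors G \<pi>1 \<longleftrightarrow> almost_invariant_vectors G \<pi>2"
proof -
  obtain S where S: "finite S" "S \<subseteq> carrier G" "generate G S = carrier G"
    using assms(2) by (auto simp: finitely_generated_def)
  have rep: "orthogonal_representation G \<pi>1" "orthogonal_representation G \<pi>2"
    using assms(5,6) by (auto intro: unitary_imp_orthogonal_representation)
  show ?thesis
    unfolding almost_invariant_vectors_iff_not_bij_laplacian[OF assms(1) S rep(1)]
      almost_invariant_vectors_iff_not_bij_laplacian[OF assms(1) S rep(2)]
      bij_laplacian_conjugate[OF assms(1) S(2) assms(7)] by (rule refl)
qed

end
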